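(* Let $(x_k),(d_k),(t_k),(\beta_k)$ be generated by the nonlinear vector Riemannian conjugate gradient method described in the context. Assume that for each $k\ge 1$, $\beta_k^{\mathrm{CD}}\ge\beta_k>0$, where $$\beta_k^{\mathrm{CD}}=\frac{\psi_{x_k,v_k}(0)}{\psi_{x_{k-1},d_{k-1}}(0)},$$ and that each $t_k$ satisfies the strong Wolfe conditions $$F(R_{x_k}(t_kd_k))\preceq_K F(x_k)+c_1t_k\,\varphi(\mathrm DF(x_k)[d_k])\,e,\qquad |\psi_{x_k,d_k}(t_kd_k)|\le c_2\,|\psi_{x_k,d_k}(0)|.$$ If $v(x_k)\ne 0$ for each $k\ge 0$, then for each $k\ge 0$ $$\psi_{x_k,d_k}(0)\le(1-c_2)\,\psi_{x_k,v_k}(0)<0.$$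
   Context: $K\subset\mathbb R^m$ is a closed, convex, pointed ($K\cap(-K)=\{0\}$) cone with nonempty interior; $u\preceq_K v$ means $v-u\in K$. $K^*=\{\omega\in\mathbb R^m\mid \omega^Ty\ge 0\ \text{for all } y\in K\}$, and $C\subset K^*\setminus\{0\}$ is a compact set such that $K^*$ is the cone generated by the convex hull of $C$. $\varphi:\mathbb R^m\to\mathbb R$ is $\varphi(y)=\sup\{y^Tw\mid w\in C\}$. $e\in K$ is a fixed vector with $0<\langle\omega,e\rangle\le 1$ for all $\omega\in C$, and $0<c_1<c_2<1$ are fixed constants. $\mathcal M$ is an $n$-dimensional smooth Riemannian manifold; $\|\cdot\|$ is the norm induced by the metric on tangent spaces. $F:\mathcal M\to\mathbb R^m$ is continuously differentiable with derivative $\mathrm DF(x):T_x\mathcal M\to\mathbb R^m$. $R:T\mathcal M\to\mathcal M$ is a retraction, i.e. a smooth map whose restrictions $R_x$ to $T_x\mathcal M$ satisfy $R_x(0_x)=x$ and $\mathrm DR_x(0_x)=\mathrm{id}_{T_x\mathcal M}$. For $x\in\mathcal M$, $v(x)$ is the unique minimizer over $d\in T_x\mathcal M$ of $\varphi(\mathrm DF(x)[d])+\|d\|^2/2$; $v_k:=v(x_k)$. For $x\in\mathcal M$, $d\in T_x\mathcal M$, $t\ge 0$, put $\psi_{x,d}(td):=\varphi\big(\mathrm DF(R_x(td))[\mathrm DR_x(td)[d]]\big)$, so $\psi_{x,d}(0)=\varphi(\mathrm DF(x)[d])$. The nonlinear vector Riemannian conjugate gradient method: start from $x_0\in\mathcal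 M$; at iteration $k$ stop if $v(x_k)=0$; otherwise set $d_0=v(x_0)$ and, for $k\ge 1$, $d_k=v(x_k)+\beta_k\mathcal T^{k-1}(d_{k-1})$, where $\beta_k\in\mathbb R$ is an algorithmic parameter and $\mathcal T^{k-1}(d_{k-1}):=\mathrm DR_{x_{k-1}}(t_{k-1}d_{k-1})[d_{k-1}]\in T_{x_k}\mathcal M$; choose a step size $t_k>0$ and set $x_{k+1}=R_{x_k}(t_kd_k)$. *)

theory Defs
  imports "HOL-Analysis.Analysis" "HOL-Library.Function_Algebras"
begin

section \<open>Pointwise real vector space structure on functions\<close>

instantiation "fun" :: (type, real_vector) real_vector
begin

definition scaleR_fun :: "real \<Rightarrow> ('a \<Rightarrow> 'b) \<Rightarrow> 'a \<Rightarrow> 'b" where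
  "scaleR_fun r f = (\<lambda>x. r *\<^sub>R f x)"

instance
  by standard (auto simp: scaleR_fun_def fun_eq_iff algebra_simps)

end


section \<open>Smooth functions on open subsets of Euclidean spaces\<close>

text \<open>
  Only meaningful for open \<open>S\<close>: \<open>f\<close> is \<open>k\<close> times continuously differentiable on \<open>S\<close>.
\<close>

fun Ck_on :: "nat \<Rightarrow> 'e::euclidean_space set \<Rightarrow> ('e \<Rightarrow> 'f::real_normed_vector) \<Rightarrow> bool" where
  "Ck_on 0 S f \<longleftrightarrow> continuous_on S f"
| "Ck_on (Suc k) S f \<longleftrightarrow>
     (\<forall>x\<in>S. f differentiable (at x)) \<and>
     (\<forall>v. Ck_on k S (\<lambda>x. frechet_derivative f (at x) v))"

definition smooth_on :: "'e::euclidean_space set \<Rightarrow> ('e \<Rightarrow> 'f::real_normed_vector) \<Rightarrow> bool" where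
  "smooth_on S f \<longleftrightarrow> (\<forall>k. Ck_on k S f)"


section \<open>Smooth manifolds\<close>

text \<open>
  A chart is a domain together with a coordinate map; the values of the map outside the domain
  are irrelevant.
\<close>

type_synonym ('a, 'e) chart = "'a set \<times> ('a \<Rightarrow> 'e)"

definition chart_inv :: "('a, 'e) chart \<Rightarrow> 'e \<Rightarrow> 'a" where
  "chart_inv c = inv_into (fst c) (snd c)"

definition atlas_carrier :: "('a, 'e) chart set \<Rightarrow> 'a set" where
  "atlas_carrier A = (\<Union>c\<in>A. fst c)"

text \<open>
  The smooth structure on the topological space \<open>M\<close> is given by an atlas, which need not be
  maximal. The dimension of the manifold is \<open>DIM('e)\<close>.
\<close>

definition smooth_manifold :: "'a topology \<Rightarrow> ('a, 'e::euclidean_space) chart set \<Rightarrow> bool" where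
  "smooth_manifold M A \<longleftrightarrow>
     Hausdorff_space M \<and> second_countable M \<and> atlas_carrier A = topspace M \<and>
     (\<forall>c\<in>A. openin M (fst c) \<and> open (snd c ` fst c) \<and>
        homeomorphic_map (subtopology M (fst c)) (top_of_set (snd c ` fst c)) (snd c)) \<and>
     (\<forall>c\<in>A. \<forall>c'\<in>A. smooth_on (snd c ` (fst c \<inter> fst c')) (snd c' \<circ> chart_inv c))"

text \<open>
  Smoothness of a map between manifolds, read in charts. Openness of the sets
  \<open>snd c ` (fst c \<inter> f -` fst c')\<close> expresses continuity of \<open>f\<close>.
\<close>

definition smooth_map ::
  "('a, 'e::euclidean_space) chart set \<Rightarrow> ('b, 'f::euclidean_space) chart set \<Rightarrow> ('a \<Rightarrow> 'b) \<Rightarrow> bool"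
where
  "smooth_map A B f \<longleftrightarrow>
     f ` atlas_carrier A \<subseteq> atlas_carrier B \<and>
     (\<forall>c\<in>A. \<forall>c'\<in>B.
        open (snd c ` (fst c \<inter> f -` fst c')) \<and>
        smooth_on (snd c ` (fst c \<inter> f -` fst c')) (snd c' \<circ> f \<circ> chart_inv c))"

definition C1_function ::
  "('a, 'e::euclidean_space) chart set \<Rightarrow> ('a \<Rightarrow> 'b::real_normed_vector) \<Rightarrow> bool" where
  "C1_function A F \<longleftrightarrow> (\<forall>c\<in>A. Ck_on 1 (snd c ` fst c) (F \<circ> chart_inv c))"


section \<open>Tangent spaces and derivatives\<close>

text \<open>
  A tangent vector at \<open>p\<close> is the family of its coordinate vectors with respect to all charts
  around \<open>p\<close>, related by the Jacobians of the chart transitions. Being extended by \<open>0\<close> to all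
  other charts, the tangent vectors at \<open>p\<close> form a linear subspace of the functions from charts
  to \<open>'e\<close>.
\<close>

type_synonym ('a, 'e) tangent_vector = "('a, 'e) chart \<Rightarrow> 'e"

definition tangent_space ::
  "('a, 'e::euclidean_space) chart set \<Rightarrow> 'a \<Rightarrow> ('a, 'e) tangent_vector set" where
  "tangent_space A p =
     {X. (\<forall>c. c \<notin> A \<or> p \<notin> fst c \<longrightarrow> X c = 0) \<and>
         (\<forall>c\<in>A. \<forall>c'\<in>A. p \<in> fst c \<and> p \<in> fst c' \<longrightarrow>
            X c' = frechet_derivative (snd c' \<circ> chart_inv c) (at (snd c p)) (X c))}"

text \<open>The tangent vector at \<open>p\<close> with coordinates \<open>w\<close> in the chart \<open>c\<close>.\<close>

definition tangent_of_coords ::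
  "('a, 'e::euclidean_space) chart set \<Rightarrow> ('a, 'e) chart \<Rightarrow> 'a \<Rightarrow> 'e \<Rightarrow> ('a, 'e) tangent_vector"
where
  "tangent_of_coords A c p = inv_into (tangent_space A p) (\<lambda>X. X c)"

text \<open>The atlas of the tangent bundle, whose elements are pairs of a base point and a vector.\<close>

definition tangent_bundle_atlas ::
  "('a, 'e::euclidean_space) chart set \<Rightarrow> ('a \<times> ('a, 'e) tangent_vector, 'e \<times> 'e) chart set" where
  "tangent_bundle_atlas A =
     (\<lambda>c. (Sigma (fst c) (tangent_space A), \<lambda>(p, X). (snd c p, X c))) ` A"

definition chart_at :: "('a, 'e) chart set \<Rightarrow> 'a \<Rightarrow> ('a, 'e) chart" where
  "chart_at A p = (SOME c. c \<in> A \<and> p \<in> fst c)"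

text \<open>
  The derivative at \<open>x\<close> of a vector-valued function on the manifold. By the chain rule it does not
  depend on the chart used.
\<close>

definition differential ::
  "('a, 'e::euclidean_space) chart set \<Rightarrow> ('a \<Rightarrow> 'b::real_normed_vector) \<Rightarrow> 'a \<Rightarrow>
   ('a, 'e) tangent_vector \<Rightarrow> 'b" where
  "differential A F x X =
     (let c = chart_at A x in frechet_derivative (F \<circ> chart_inv c) (at (snd c x)) (X c))"

text \<open>
  The derivative at the point \<open>\<xi>\<close> of a map \<open>f\<close> from the vector space \<open>T\<^sub>x M\<close> to the
  manifold. The tangent space of \<open>T\<^sub>x M\<close> at \<open>\<xi>\<close> is identified with \<open>T\<^sub>x M\<close>, and the value at
  \<open>\<eta>\<close> is a tangent vector at \<open>f \<xi>\<close>. Again the chart used on \<open>T\<^sub>x M\<close> does not matter.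
\<close>

definition fibre_differential ::
  "('a, 'e::euclidean_space) chart set \<Rightarrow> 'a \<Rightarrow> (('a, 'e) tangent_vector \<Rightarrow> 'a) \<Rightarrow>
   ('a, 'e) tangent_vector \<Rightarrow> ('a, 'e) tangent_vector \<Rightarrow> ('a, 'e) tangent_vector" where
  "fibre_differential A x f \<xi> \<eta> =
     (let c = chart_at A x in
      (\<lambda>c'. if c' \<in> A \<and> f \<xi> \<in> fst c'
            then frechet_derivative (snd c' \<circ> f \<circ> tangent_of_coords A c x) (at (\<xi> c)) (\<eta> c)
            else 0))"


section \<open>Riemannian metrics and retractions\<close>

definition riemannian_metric ::
  "('a, 'e::euclidean_space) chart set \<Rightarrow>
   ('a \<Rightarrow> ('a, 'e) tangent_vector \<Rightarrow> ('a, 'e) tangent_vector \<Rightarrow> real) \<Rightarrow> bool" where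
  "riemannian_metric A g \<longleftrightarrow>
     (\<forall>p\<in>atlas_carrier A.
        (\<forall>X\<in>tangent_space A p. \<forall>Y\<in>tangent_space A p.
           g p X Y = g p Y X \<and>
           (\<forall>Z\<in>tangent_space A p. g p (X + Y) Z = g p X Z + g p Y Z) \<and>
           (\<forall>r. g p (r *\<^sub>R X) Y = r * g p X Y)) \<and>
        (\<forall>X\<in>tangent_space A p. X \<noteq> 0 \<longrightarrow> 0 < g p X X)) \<and>
     (\<forall>c\<in>A. \<forall>i\<in>Basis. \<forall>j\<in>Basis.
        smooth_on (snd c ` fst c)
          (\<lambda>y. let p = chart_inv c y in g p (tangent_of_coords A c p i) (tangent_of_coords A c p j)))"

definition riemannian_manifold ::
  "'a topology \<Rightarrow> ('a, 'e::euclidean_space) chart set \<Rightarrow>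
   ('a \<Rightarrow> ('a, 'e) tangent_vector \<Rightarrow> ('a, 'e) tangent_vector \<Rightarrow> real) \<Rightarrow> bool" where
  "riemannian_manifold M A g \<longleftrightarrow> smooth_manifold M A \<and> riemannian_metric A g"

definition tangent_norm ::
  "('a \<Rightarrow> ('a, 'e) tangent_vector \<Rightarrow> ('a, 'e) tangent_vector \<Rightarrow> real) \<Rightarrow>
   'a \<Rightarrow> ('a, 'e) tangent_vector \<Rightarrow> real" where
  "tangent_norm g p X = sqrt (g p X X)"

definition retraction_on ::
  "('a, 'e::euclidean_space) chart set \<Rightarrow> ('a \<Rightarrow> ('a, 'e) tangent_vector \<Rightarrow> 'a) \<Rightarrow> bool" where
  "retraction_on A R \<longleftrightarrow>
     smooth_map (tangent_bundle_atlas A) A (\<lambda>(x, X). R x X) \<and>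
     (\<forall>x\<in>atlas_carrier A. R x 0 = x \<and>
        (\<forall>X\<in>tangent_space A x. fibre_differential A x (R x) 0 X = X))"


section \<open>Cones\<close>

definition cone_le :: "'b::real_vector set \<Rightarrow> 'b \<Rightarrow> 'b \<Rightarrow> bool" where
  "cone_le K u v \<longleftrightarrow> v - u \<in> K"

definition dual_cone :: "'b::real_inner set \<Rightarrow> 'b set" where
  "dual_cone K = {\<omega>. \<forall>y\<in>K. 0 \<le> \<omega> \<bullet> y}"

definition support_fun :: "'b::real_inner set \<Rightarrow> 'b \<Rightarrow> real" where
  "support_fun C y = (SUP w\<in>C. y \<bullet> w)"


section \<open>The nonlinear vector Riemannian conjugate gradient method\<close>

definition steepest_descent ::
  "('a, 'e::euclidean_space) chart set \<Rightarrow>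
   ('a \<Rightarrow> ('a, 'e) tangent_vector \<Rightarrow> ('a, 'e) tangent_vector \<Rightarrow> real) \<Rightarrow>
   'b::real_inner set \<Rightarrow> ('a \<Rightarrow> 'b) \<Rightarrow> 'a \<Rightarrow> ('a, 'e) tangent_vector" where
  "steepest_descent A g C F x =
     (THE d. is_arg_min (\<lambda>d. support_fun C (differential A F x d) + (tangent_norm g x d)\<^sup>2 / 2)
               (\<lambda>d. d \<in> tangent_space A x) d)"

text \<open>\<open>psi A C F R x d \<xi>\<close> is $\psi_{x,d}(\xi)$; it is only used for \<open>\<xi> = t *\<^sub>R d\<close> with \<open>t \<ge> 0\<close>.\<close>

definition psi ::
  "('a, 'e::euclidean_space) chart set \<Rightarrow> 'b::real_inner set \<Rightarrow> ('a \<Rightarrow> 'b) \<Rightarrow>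
   ('a \<Rightarrow> ('a, 'e) tangent_vector \<Rightarrow> 'a) \<Rightarrow>
   'a \<Rightarrow> ('a, 'e) tangent_vector \<Rightarrow> ('a, 'e) tangent_vector \<Rightarrow> real" where
  "psi A C F R x d \<xi> =
     support_fun C (differential A F (R x \<xi>) (fibre_differential A x (R x) \<xi> d))"

text \<open>
  The method stops at the first \<open>k\<close> with \<open>steepest_descent A g C F (x k) = 0\<close>; the entries of the
  sequences that are not produced by the method are left unconstrained.
\<close>

definition ncg_generated ::
  "('a, 'e::euclidean_space) chart set \<Rightarrow>
   ('a \<Rightarrow> ('a, 'e) tangent_vector \<Rightarrow> ('a, 'e) tangent_vector \<Rightarrow> real) \<Rightarrow>
   'b::real_inner set \<Rightarrow> ('a \<Rightarrow> 'b) \<Rightarrow> ('a \<Rightarrow> ('a, 'e) tangent_vector \<Rightarrow> 'a) \<Rightarrow>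
   (nat \<Rightarrow> 'a) \<Rightarrow> (nat \<Rightarrow> ('a, 'e) tangent_vector) \<Rightarrow> (nat \<Rightarrow> real) \<Rightarrow> (nat \<Rightarrow> real) \<Rightarrow> bool" where
  "ncg_generated A g C F R x d t \<beta> \<longleftrightarrow>
     x 0 \<in> atlas_carrier A \<and>
     (\<forall>k. (\<forall>j\<le>k. steepest_descent A g C F (x j) \<noteq> 0) \<longrightarrow>
        d k = (if k = 0 then steepest_descent A g C F (x 0)
               else steepest_descent A g C F (x k) +
                    \<beta> k *\<^sub>R fibre_differential A (x (k - 1)) (R (x (k - 1)))
                             (t (k - 1) *\<^sub>R d (k - 1)) (d (k - 1))) \<and>
        0 < t k \<and>
        x (Suc k) = R (x k) (t k *\<^sub>R d k))"

end

theory Submission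
  imports Defs
begin

text \<open>
  The claim follows by induction on \<open>k\<close>. The directional value \<open>\<psi>\<^sub>k(0)\<close> at \<open>d\<^sub>k\<close> is at most
  \<open>\<phi>(DF v\<^sub>k) + \<beta>\<^sub>k \<psi>\<^sub>k\<^sub>-\<^sub>1(t\<^sub>k\<^sub>-\<^sub>1 d\<^sub>k\<^sub>-\<^sub>1)\<close> because \<open>\<phi>\<close> is sublinear. The curvature condition bounds the second
  term by \<open>- c\<^sub>2 \<beta>\<^sub>k \<psi>\<^sub>k\<^sub>-\<^sub>1(0)\<close>, and \<open>\<beta>\<^sub>k \<le> \<beta>\<^sub>k\<^sup>C\<^sup>D\<close> bounds this by \<open>- c\<^sub>2 \<phi>(DF v\<^sub>k)\<close>. Finally
  \<open>\<phi>(DF v) < 0\<close> for \<open>v \<noteq> 0\<close>, as the objective minimised by \<open>v\<close> vanishes at \<open>0\<close>.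
  Most of the work lies in showing that \<open>v(x)\<close> is a genuine minimiser, by strict convexity
  and coercivity in coordinates, and that the transported directions are tangent vectors.
\<close>

section \<open>Support functions\<close>

text \<open>A supremum of reals is only informative for a set bounded above; Cauchy-Schwarz supplies
  the bound behind every later estimate of \<open>support_fun\<close>.\<close>

lemma bdd_above_inner_image:
  fixes C :: "'b::real_inner set"
  assumes "bounded C"
  shows "bdd_above ((\<lambda>w. y \<bullet> w) ` C)"
proof -
  obtain B where "\<forall>w\<in>C. norm w \<le> B" using assms bounded_iff by blast
  then have "\<And>w. w \<in> C \<Longrightarrow> y \<bullet> w \<le> norm y * B"
    by (meson mult_left_mono norm_cauchy_schwarz norm_ge_zero order_trans)
  then show ?thesis by (auto simp: bdd_above_def)
qed

lemma inner_le_support_fun: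
  assumes "bounded C" "w \<in> C"
  shows "y \<bullet> w \<le> support_fun C y"
  unfolding support_fun_def
  by (rule cSUP_upper[OF assms(2) bdd_above_inner_image[OF assms(1)]])

lemma support_fun_zero: "C \<noteq> {} \<Longrightarrow> support_fun C 0 = 0"
  by (simp add: support_fun_def)

text \<open>Each \<open>w\<close> in \<open>C\<close> satisfies the bound separately, and the
  supremum inherits it. Two free coefficients serve both convexity and the splitting of a conjugate
  direction.\<close>

lemma support_fun_sublinear:
  assumes "bounded C" "C \<noteq> {}" "0 \<le> a" "0 \<le> b"
  shows "support_fun C (a *\<^sub>R y + b *\<^sub>R z) \<le> a * support_fun C y + b * support_fun C z"
  unfolding support_fun_def[of C "a *\<^sub>R y + b *\<^sub>R z"]
  by (rule cSUP_least)
    (use assms in \<open>auto simp: inner_add_left intro!: add_mono mult_left_mono inner_le_support_fun\<close>)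

section \<open>Quadratically regularised minimisation\<close>

lemma continuous_on_bilinear_diagonal:
  fixes B :: "'e::euclidean_space \<Rightarrow> 'e \<Rightarrow> real"
  assumes "bilinear B"
  shows "continuous_on S (\<lambda>u. B u u)"
  using assms bounded_bilinear.continuous_on[OF _ continuous_on_id continuous_on_id]
  by (simp add: bilinear_conv_bounded_bilinear)

text \<open>The constant is the minimum of \<open>B u u\<close> over the compact unit sphere,
  positive by definiteness; homogeneity of degree two extends the bound to all vectors.\<close>

lemma bilinear_pos_def_coercive:
  fixes B :: "'e::euclidean_space \<Rightarrow> 'e \<Rightarrow> real"
  assumes B: "bilinear B" and pos: "\<And>u. u \<noteq> 0 \<Longrightarrow> 0 < B u u"
  obtains a where "0 < a" "\<And>u. a * (norm u)\<^sup>2 \<le> B u u"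
proof -
  have cont: "continuous_on S (\<lambda>u. B u u)" for S
    using continuous_on_bilinear_diagonal[OF B] .
  obtain s where s: "s \<in> sphere 0 1" "\<And>u. u \<in> sphere 0 1 \<Longrightarrow> B s s \<le> B u u"
    using continuous_attains_inf[OF compact_sphere _ cont, of 0 1] by auto
  have "B s s * (norm u)\<^sup>2 \<le> B u u" for u
  proof (cases "u = 0")
    case True
    then show ?thesis using B by (simp add: bilinear_lzero)
  next
    case False
    define w where "w = u /\<^sub>R norm u"
    have "B s s \<le> B w w" using False by (intro s) (simp add: w_def)
    moreover have "B u u = (norm u)\<^sup>2 * B w w"
      using False
      by (simp add: w_def bilinear_lmul[OF B] bilinear_rmul[OF B] power2_eq_square field_simps)
    ultimately show ?thesis
      by (simp add: mult.commute mult_right_mono)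
  qed
  moreover have "0 < B s s" using s(1) by (intro pos) auto
  ultimately show ?thesis using that by blast
qed

text \<open>The quadratic term outgrows the linear lower bound, so a minimiser over a large closed
  ball is a global one.\<close>

lemma ex_arg_min_quadratic_regularisation:
  fixes h :: "'e::euclidean_space \<Rightarrow> real"
  assumes B: "bilinear B" and pos: "\<And>u. u \<noteq> 0 \<Longrightarrow> 0 < B u u"
    and h: "convex_on UNIV h" and lower: "\<And>u. - b * norm u \<le> h u" and zero: "h 0 \<le> 0"
  shows "\<exists>u. \<forall>w. h u + B u u / 2 \<le> h w + B w w / 2"
proof -
  let ?f = "\<lambda>u. h u + B u u / 2"
  obtain a where a: "0 < a" "\<And>u. a * (norm u)\<^sup>2 \<le> B u u"
    using bilinear_pos_def_coercive[OF B pos] by blast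
  have "continuous_on UNIV h" using convex_on_continuous[OF _ h] by simp
  then have cont: "continuous_on S ?f" for S
    using continuous_on_subset[of UNIV h S]
    by (intro continuous_on_add continuous_on_divide continuous_on_bilinear_diagonal[OF B]) auto
  \<comment> \<open>Beyond this radius \<open>a * (norm w)\<^sup>2 / 2\<close> dominates
    \<open>\<bar>b\<bar> * norm w\<close>, so the objective is nonnegative there.\<close>
  define r where "r = 2 * \<bar>b\<bar> / a"
  have "cball (0 :: 'e) r \<noteq> {}" using a(1) by (simp add: r_def not_less)
  then obtain u where u: "\<And>w. w \<in> cball 0 r \<Longrightarrow> ?f u \<le> ?f w"
    using continuous_attains_inf[OF compact_cball _ cont] by blast
  have "?f u \<le> ?f w" for w
  proof (cases "norm w \<le> r")
    case True
    then show ?thesis using u by simp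
  next
    case False
    \<comment> \<open>The centre 0 belongs to the ball and its objective value is at most 0.\<close>
    have "?f u \<le> 0"
      using u[of 0] zero a(1) B by (simp add: r_def bilinear_lzero)
    also have "0 \<le> (a * norm w / 2 - \<bar>b\<bar>) * norm w"
      using False a(1) by (intro mult_nonneg_nonneg) (auto simp: r_def field_simps)
    also have "\<dots> \<le> a * (norm w)\<^sup>2 / 2 - b * norm w"
      by (simp add: algebra_simps power2_eq_square mult_right_mono)
    also have "\<dots> \<le> ?f w"
      using a(2)[of w] lower[of w] by simp
    finally show ?thesis .
  qed
  then show ?thesis by blast
qed

text \<open>The midpoint of two distinct minimisers would do strictly better: \<open>h\<close> is
  convex, and the parallelogram identity makes the quadratic part drop.\<close>

lemma arg_min_quadratic_regularisation_unique:
  fixes h :: "'e::real_vector \<Rightarrow> real"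
  assumes B: "bilinear B" and pos: "\<And>u. u \<noteq> 0 \<Longrightarrow> 0 < B u u"
    and h: "convex_on UNIV h"
    and u: "\<And>w. h u + B u u / 2 \<le> h w + B w w / 2"
    and u': "\<And>w. h u' + B u' u' / 2 \<le> h w + B w w / 2"
  shows "u = u'"
proof (rule ccontr)
  assume "u \<noteq> u'"
  then have p: "0 < B (u - u') (u - u')" using pos by simp
  define m where "m = (1/2) *\<^sub>R u + (1/2) *\<^sub>R u'"
  have "h m \<le> h u / 2 + h u' / 2"
    using convex_onD[OF h, of "1/2" u u'] by (simp add: m_def)
  moreover have "B m m = B u u / 2 + B u' u' / 2 - B (u - u') (u - u') / 4"
    by (simp add: m_def bilinear_ladd[OF B] bilinear_radd[OF B] bilinear_lmul[OF B]
        bilinear_rmul[OF B] bilinear_lsub[OF B] bilinear_rsub[OF B] field_simps)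
  ultimately show False using u[of m] u'[of m] p by argo
qed

section \<open>Tangent spaces in coordinates\<close>

lemma smooth_on_imp_differentiable:
  "smooth_on S f \<Longrightarrow> y \<in> S \<Longrightarrow> f differentiable (at y)"
  by (auto simp: smooth_on_def dest!: spec[of _ "Suc 0"])

lemma transition_differentiable:
  assumes "smooth_manifold M A" "c \<in> A" "c' \<in> A" "p \<in> fst c" "p \<in> fst c'"
  shows "(snd c' \<circ> chart_inv c) differentiable (at (snd c p))"
  using assms by (auto simp: smooth_manifold_def intro!: smooth_on_imp_differentiable)

lemma inj_on_chart:
  assumes "smooth_manifold M A" "c \<in> A"
  shows "inj_on (snd c) (fst c)"
proof -
  have "openin M (fst c)"
    and "homeomorphic_map (subtopology M (fst c)) (top_of_set (snd c ` fst c)) (snd c)"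
    using assms by (auto simp: smooth_manifold_def)
  then show ?thesis
    using homeomorphic_imp_injective_map openin_subset by (fastforce simp: Int_absorb1)
qed

lemma chart_inv_chart:
  assumes "smooth_manifold M A" "c \<in> A" "p \<in> fst c"
  shows "chart_inv c (snd c p) = p"
  using inj_on_chart[OF assms(1,2)] assms(3) by (simp add: chart_inv_def)

lemma chart_at_mem:
  assumes "p \<in> atlas_carrier A"
  shows "chart_at A p \<in> A" "p \<in> fst (chart_at A p)"
proof -
  have "\<exists>c. c \<in> A \<and> p \<in> fst c" using assms by (auto simp: atlas_carrier_def)
  then have "chart_at A p \<in> A \<and> p \<in> fst (chart_at A p)"
    unfolding chart_at_def by (rule someI_ex)
  then show "chart_at A p \<in> A" "p \<in> fst (chart_at A p)" by auto
qed

lemma tangent_space_outside: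
  "X \<in> tangent_space A p \<Longrightarrow> c \<notin> A \<or> p \<notin> fst c \<Longrightarrow> X c = 0"
  unfolding tangent_space_def by blast

lemma tangent_space_transition:
  assumes "X \<in> tangent_space A p" "c \<in> A" "c' \<in> A" "p \<in> fst c" "p \<in> fst c'"
  shows "X c' = frechet_derivative (snd c' \<circ> chart_inv c) (at (snd c p)) (X c)"
  using assms unfolding tangent_space_def by blast

text \<open>The transition law is a linear condition because the transition maps are differentiable,
  which is what makes \<open>frechet_derivative\<close> a linear map.\<close>

lemma subspace_tangent_space:
  assumes M: "smooth_manifold M A"
  shows "subspace (tangent_space A p)"
proof -
  have lin: "linear (frechet_derivative (snd c' \<circ> chart_inv c) (at (snd c p)))"
    if "c \<in> A" "c' \<in> A" "p \<in> fst c" "p \<in> fst c'" for c c'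
    using transition_differentiable[OF M that] by (rule linear_frechet_derivative)
  show ?thesis
  proof (rule subspaceI)
    show "0 \<in> tangent_space A p"
      by (auto simp: tangent_space_def linear_0[OF lin])
    fix X assume X: "X \<in> tangent_space A p"
    show "r *\<^sub>R X \<in> tangent_space A p" for r
      unfolding tangent_space_def
      using tangent_space_outside[OF X]
      by (auto simp: scaleR_fun_def linear_scale[OF lin] tangent_space_transition[OF X, symmetric])
    fix Y assume Y: "Y \<in> tangent_space A p"
    show "X + Y \<in> tangent_space A p"
      unfolding tangent_space_def
      using tangent_space_outside[OF X] tangent_space_outside[OF Y]
      by (auto simp: linear_add[OF lin] tangent_space_transition[OF X, symmetric]
          tangent_space_transition[OF Y, symmetric])
  qed
qed

text \<open>One coordinate vector determines all others: by the transition law on charts around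
  \<open>p\<close>, and by the default 0 elsewhere.\<close>

lemma inj_on_tangent_coords:
  assumes M: "smooth_manifold M A" and c: "c \<in> A" "p \<in> fst c"
  shows "inj_on (\<lambda>X. X c) (tangent_space A p)"
proof (rule inj_onI)
  fix X Y assume XY: "X \<in> tangent_space A p" "Y \<in> tangent_space A p" "X c = Y c"
  show "X = Y"
  proof
    fix c'
    show "X c' = Y c'"
    proof (cases "c' \<in> A \<and> p \<in> fst c'")
      case True
      then show ?thesis
        using tangent_space_transition[OF XY(1) c(1) _ c(2)]
          tangent_space_transition[OF XY(2) c(1) _ c(2)] XY(3) by simp
    next
      case False
      then show ?thesis
        using tangent_space_outside[OF XY(1)] tangent_space_outside[OF XY(2)] by simp
    qed
  qed
qed

lemma tangent_of_coords_coords: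
  assumes "smooth_manifold M A" "c \<in> A" "p \<in> fst c" "X \<in> tangent_space A p"
  shows "tangent_of_coords A c p (X c) = X"
  using inv_into_f_f[OF inj_on_tangent_coords[OF assms(1-3)] assms(4)]
  by (simp add: tangent_of_coords_def)

section \<open>Retractions\<close>

lemma retraction_mem_carrier:
  assumes R: "retraction_on A R" and x: "x \<in> atlas_carrier A" and \<xi>: "\<xi> \<in> tangent_space A x"
  shows "R x \<xi> \<in> atlas_carrier A"
proof -
  have "(x, \<xi>) \<in> atlas_carrier (tangent_bundle_atlas A)"
    using x \<xi> by (fastforce simp: atlas_carrier_def tangent_bundle_atlas_def)
  then show ?thesis
    using R by (fastforce simp: retraction_on_def smooth_map_def)
qed

text \<open>Smoothness of \<open>R\<close> is given on the whole tangent bundle; freezing the base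
  coordinate at \<open>snd c x\<close> yields regularity on the single fibre over
  \<open>x\<close>.\<close>

lemma retraction_in_coords:
  fixes A :: "('a, 'e::euclidean_space) chart set"
  assumes M: "smooth_manifold M A" and R: "retraction_on A R"
    and c: "c \<in> A" "x \<in> fst c" and c': "c' \<in> A" "R x \<xi> \<in> fst c'"
    and \<xi>: "\<xi> \<in> tangent_space A x"
  obtains U where "open U" "\<xi> c \<in> U" "U \<subseteq> (\<lambda>X. X c) ` tangent_space A x"
    "\<And>w. w \<in> U \<Longrightarrow> R x (tangent_of_coords A c x w) \<in> fst c'"
    "(snd c' \<circ> R x \<circ> tangent_of_coords A c x) differentiable (at (\<xi> c))"
proof -
  define D where "D = Sigma (fst c) (tangent_space A)"
  define \<kappa> where "\<kappa> = (\<lambda>(p, X :: ('a, 'e) tangent_vector). (snd c p, X c))"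
  define f where "f = (\<lambda>(x, X). R x X)"
  define S where "S = \<kappa> ` (D \<inter> f -` fst c')"
  have "(D, \<kappa>) \<in> tangent_bundle_atlas A"
    using c by (auto simp: tangent_bundle_atlas_def D_def \<kappa>_def)
  then have S: "open S" "smooth_on S (snd c' \<circ> f \<circ> chart_inv (D, \<kappa>))"
    using R c'(1) by (auto simp: retraction_on_def smooth_map_def S_def f_def)
  have inj: "inj_on \<kappa> D"
    using inj_on_chart[OF M c(1)] inj_on_tangent_coords[OF M c(1)]
    by (auto simp: inj_on_def \<kappa>_def D_def)
  define U where "U = (\<lambda>w. (snd c x, w)) -` S"
  have "open U"
    unfolding U_def by (intro open_vimage S continuous_intros)
  moreover have U_mem: "\<xi> c \<in> U"
    using \<xi> c c' by (force simp: U_def S_def \<kappa>_def D_def f_def)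
  \<comment> \<open>Injectivity of \<open>snd c\<close> forces a bundle point with base coordinate
    \<open>snd c x\<close> to lie over \<open>x\<close>.\<close>
  moreover have U: "\<exists>X\<in>tangent_space A x. w = X c \<and> R x X \<in> fst c'" if "w \<in> U" for w
    using that inj_on_chart[OF M c(1)] c(2) unfolding U_def S_def \<kappa>_def D_def f_def inj_on_def
    by auto
  then have "U \<subseteq> (\<lambda>X. X c) ` tangent_space A x" by blast
  moreover have "R x (tangent_of_coords A c x w) \<in> fst c'" if "w \<in> U" for w
    using U[OF that] tangent_of_coords_coords[OF M c] by auto
  moreover have "(snd c' \<circ> R x \<circ> tangent_of_coords A c x) differentiable (at (\<xi> c))"
  proof -
    let ?G = "snd c' \<circ> f \<circ> chart_inv (D, \<kappa>)"
    have "(\<lambda>w. ?G (snd c x, w)) differentiable (at (\<xi> c))"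
      using U_mem smooth_on_imp_differentiable[OF S(2)]
      by (intro differentiable_compose[of ?G "\<lambda>w. (snd c x, w)"])
        (auto simp: U_def differentiable_def intro!: derivative_eq_intros)
    moreover have "?G (snd c x, w) = (snd c' \<circ> R x \<circ> tangent_of_coords A c x) w" if "w \<in> U" for w
    proof -
      obtain X where X: "X \<in> tangent_space A x" "w = X c" using U[OF \<open>w \<in> U\<close>] by auto
      then have "chart_inv (D, \<kappa>) (\<kappa> (x, X)) = (x, X)"
        using inv_into_f_f[OF inj, of "(x, X)"] c(2) by (simp add: chart_inv_def D_def)
      then show ?thesis
        using X tangent_of_coords_coords[OF M c X(1)] by (simp add: \<kappa>_def f_def)
    qed
    ultimately show ?thesis
      using \<open>open U\<close> U_mem unfolding differentiable_def
      by (meson has_derivative_transform_within_open)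
  qed
  ultimately show ?thesis using that by blast
qed

text \<open>
  Surjectivity is where the retraction helps: its chart representation is defined on an open set,
  which forces the coordinates of \<open>T\<^sub>x M\<close> to contain a neighbourhood of \<open>0\<close>; no cocycle
  condition for the transition maps is needed.
\<close>

lemma bij_betw_tangent_coords:
  fixes A :: "('a, 'e::euclidean_space) chart set"
  assumes M: "smooth_manifold M A" and R: "retraction_on A R" and c: "c \<in> A" "x \<in> fst c"
  shows "bij_betw (\<lambda>X. X c) (tangent_space A x) UNIV"
proof -
  let ?W = "(\<lambda>X. X c) ` tangent_space A x"
  have T: "subspace (tangent_space A x)" by (rule subspace_tangent_space[OF M])
  have "R x 0 = x" using R c by (auto simp: retraction_on_def atlas_carrier_def)
  then have "R x 0 \<in> fst c" using c(2) by simp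
  then obtain U where U: "open U" "(0 :: ('a, 'e) tangent_vector) c \<in> U" "U \<subseteq> ?W"
    using retraction_in_coords[OF M R c c(1) _ subspace_0[OF T]] by metis
  have "w \<in> ?W" for w
  proof -
    obtain \<epsilon> where \<epsilon>: "0 < \<epsilon>" "ball 0 \<epsilon> \<subseteq> U"
      using openE[OF U(1,2)] by auto
    \<comment> \<open>The factor shrinks \<open>w\<close> into the ball, and subspace scaling undoes
      it; the summand 1 covers \<open>w = 0\<close>.\<close>
    define r where "r = \<epsilon> / (norm w + 1)"
    have n: "0 < norm w + 1" by (simp add: add_nonneg_pos)
    then have r: "0 < r" using \<epsilon>(1) by (simp add: r_def)
    have "r * norm w < r * (norm w + 1)" using r by simp
    also have "\<dots> = \<epsilon>" using n by (simp add: r_def)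
    finally have "norm (r *\<^sub>R w) < \<epsilon>" using r by simp
    then have "r *\<^sub>R w \<in> ?W"
      by (intro subsetD[OF U(3)] subsetD[OF \<epsilon>(2)]) (simp only: mem_ball_0)
    then obtain X where X: "X \<in> tangent_space A x" "r *\<^sub>R w = X c" by auto
    have "w = (inverse r *\<^sub>R X) c"
      using r X(2)[symmetric] by (simp add: scaleR_fun_def)
    then show ?thesis using subspace_scale[OF T X(1)] by blast
  qed
  then show ?thesis
    using inj_on_tangent_coords[OF M c] by (auto simp: bij_betw_def)
qed

text \<open>The transition law for the image vector is the chain rule for a chart transition
  composed with the coordinate form of \<open>R x\<close>.\<close>

lemma fibre_differential_mem_tangent_space:
  assumes M: "smooth_manifold M A" and R: "retraction_on A R" and x: "x \<in> atlas_carrier A"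
    and \<xi>: "\<xi> \<in> tangent_space A x"
  shows "fibre_differential A x (R x) \<xi> \<eta> \<in> tangent_space A (R x \<xi>)"
proof -
  define c where "c = chart_at A x"
  have c: "c \<in> A" "x \<in> fst c" using chart_at_mem[OF x] by (simp_all add: c_def)
  let ?\<tau> = "tangent_of_coords A c x"
  have \<tau>: "?\<tau> (\<xi> c) = \<xi>" by (rule tangent_of_coords_coords[OF M c \<xi>])
  have transition: "frechet_derivative (snd c2 \<circ> R x \<circ> ?\<tau>) (at (\<xi> c)) (\<eta> c) =
      frechet_derivative (snd c2 \<circ> chart_inv c1) (at (snd c1 (R x \<xi>)))
        (frechet_derivative (snd c1 \<circ> R x \<circ> ?\<tau>) (at (\<xi> c)) (\<eta> c))"
    if c1: "c1 \<in> A" "R x \<xi> \<in> fst c1" and c2: "c2 \<in> A" "R x \<xi> \<in> fst c2" for c1 c2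
  proof -
    let ?f = "snd c1 \<circ> R x \<circ> ?\<tau>" and ?h = "snd c2 \<circ> chart_inv c1"
    obtain U where U: "open U" "\<xi> c \<in> U" "\<And>w. w \<in> U \<Longrightarrow> R x (?\<tau> w) \<in> fst c1"
      and f: "?f differentiable (at (\<xi> c))"
      using retraction_in_coords[OF M R c c1 \<xi>] by metis
    have h: "?h differentiable (at (?f (\<xi> c)))"
      using transition_differentiable[OF M c1(1) c2(1) c1(2) c2(2)] by (simp add: \<tau>)
    \<comment> \<open>On \<open>U\<close> the retraction stays inside the domain of
      \<open>c1\<close>, so \<open>chart_inv c1\<close> cancels \<open>snd c1\<close> near
      \<open>\<xi> c\<close>.\<close>
    have "frechet_derivative (?h \<circ> ?f) (at (\<xi> c)) =
        frechet_derivative (snd c2 \<circ> R x \<circ> ?\<tau>) (at (\<xi> c))"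
      by (rule frechet_derivative_transform_within_open[OF differentiable_chain_at[OF f h] U(1,2)])
        (simp add: chart_inv_chart[OF M c1(1) U(3)])
    moreover have "?f (\<xi> c) = snd c1 (R x \<xi>)" by (simp add: \<tau>)
    ultimately show ?thesis
      using frechet_derivative_compose[OF f h] by (metis comp_apply)
  qed
  show ?thesis
    using transition[symmetric]
    by (auto simp: tangent_space_def fibre_differential_def Let_def c_def)
qed

section \<open>The steepest descent direction\<close>

lemma differential_linear:
  assumes F: "C1_function A F" and x: "x \<in> atlas_carrier A"
  shows "differential A F x (a *\<^sub>R X + b *\<^sub>R Y) =
    a *\<^sub>R differential A F x X + b *\<^sub>R differential A F x Y"
proof -
  let ?c = "chart_at A x"
  have "(F \<circ> chart_inv ?c) differentiable (at (snd ?c x))"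
    using F chart_at_mem[OF x] by (auto simp: C1_function_def)
  then have lin: "linear (frechet_derivative (F \<circ> chart_inv ?c) (at (snd ?c x)))"
    by (rule linear_frechet_derivative)
  show ?thesis
    by (simp add: differential_def Let_def scaleR_fun_def linear_add[OF lin] linear_scale[OF lin])
qed

lemma tangent_norm_squared:
  assumes g: "riemannian_metric A g" and x: "x \<in> atlas_carrier A" and X: "X \<in> tangent_space A x"
  shows "(tangent_norm g x X)\<^sup>2 = g x X X" "X \<noteq> 0 \<Longrightarrow> 0 < g x X X"
proof -
  show pos: "X \<noteq> 0 \<Longrightarrow> 0 < g x X X"
    using g x X by (auto simp: riemannian_metric_def)
  \<comment> \<open>Positivity is postulated for nonzero vectors only; homogeneity settles
    \<open>X = 0\<close>.\<close>
  have "g x (0 *\<^sub>R X) X = 0 * g x X X"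
    using g x X unfolding riemannian_metric_def by blast
  then have "0 \<le> g x X X" using pos by (cases "X = 0") auto
  then show "(tangent_norm g x X)\<^sup>2 = g x X X" by (simp add: tangent_norm_def)
qed

text \<open>The definite description needs a unique minimiser. The linear bijection \<tau> carries
  the problem to coordinates, where the regularisation lemmas apply.\<close>

lemma steepest_descent_arg_min:
  fixes A :: "('a, 'e::euclidean_space) chart set" and C :: "'b::euclidean_space set"
  assumes M: "riemannian_manifold M A g" and R: "retraction_on A R" and F: "C1_function A F"
    and C: "bounded C" "C \<noteq> {}" and x: "x \<in> atlas_carrier A"
  shows "is_arg_min (\<lambda>d. support_fun C (differential A F x d) + (tangent_norm g x d)\<^sup>2 / 2)
    (\<lambda>d. d \<in> tangent_space A x) (steepest_descent A g C F x)"
proof -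
  have M': "smooth_manifold M A" and g: "riemannian_metric A g"
    using M by (auto simp: riemannian_manifold_def)
  define c where "c = chart_at A x"
  have c: "c \<in> A" "x \<in> fst c" using chart_at_mem[OF x] by (simp_all add: c_def)
  define \<tau> where "\<tau> = tangent_of_coords A c x"
  let ?T = "tangent_space A x"
  have T: "subspace ?T" by (rule subspace_tangent_space[OF M'])
  have bij: "bij_betw (\<lambda>X. X c) ?T UNIV" by (rule bij_betw_tangent_coords[OF M' R c])
  have \<tau>_mem: "\<tau> u \<in> ?T" for u
    using bij inv_into_into[of u "\<lambda>X. X c" ?T] by (simp add: \<tau>_def tangent_of_coords_def bij_betw_def)
  have \<tau>_coords: "\<tau> (X c) = X" if "X \<in> ?T" for X
    unfolding \<tau>_def by (rule tangent_of_coords_coords[OF M' c that])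
  have coords_\<tau>: "\<tau> u c = u" for u
    using bij f_inv_into_f[of u "\<lambda>X. X c" ?T] by (simp add: \<tau>_def tangent_of_coords_def bij_betw_def)
  have \<tau>_lin: "\<tau> (a *\<^sub>R u + b *\<^sub>R w) = a *\<^sub>R \<tau> u + b *\<^sub>R \<tau> w" for a b u w
  proof -
    have "a *\<^sub>R \<tau> u + b *\<^sub>R \<tau> w \<in> ?T"
      by (intro subspace_add[OF T] subspace_scale[OF T] \<tau>_mem)
    from \<tau>_coords[OF this] show ?thesis by (simp add: scaleR_fun_def coords_\<tau>)
  qed
  \<comment> \<open>This is the metric at \<open>x\<close> read in coordinates.\<close>
  define B where "B = (\<lambda>u w. g x (\<tau> u) (\<tau> w))"
  have g_sym: "g x X Y = g x Y X" and g_scale: "g x (r *\<^sub>R X) Y = r * g x X Y"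
    if "X \<in> ?T" "Y \<in> ?T" for X Y r
    using g x that unfolding riemannian_metric_def by blast+
  have g_add: "g x (X + Y) Z = g x X Z + g x Y Z" if "X \<in> ?T" "Y \<in> ?T" "Z \<in> ?T" for X Y Z
    using g x that unfolding riemannian_metric_def by blast
  have \<tau>_add: "\<tau> (u + w) = \<tau> u + \<tau> w" for u w using \<tau>_lin[of 1 u 1 w] by simp
  have \<tau>_scale: "\<tau> (r *\<^sub>R u) = r *\<^sub>R \<tau> u" for r u using \<tau>_lin[of r u 0 0] by simp
  have B_sym: "B u w = B w u" for u w unfolding B_def by (rule g_sym[OF \<tau>_mem \<tau>_mem])
  have lin: "linear (\<lambda>u. B u w)" for w
    by (rule linearI) (simp_all add: B_def \<tau>_add \<tau>_scale g_add g_scale \<tau>_mem)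
  moreover have "linear (B u)" for u
    using lin[of u] by (simp add: B_sym[of _ u])
  ultimately have B: "bilinear B" by (simp add: bilinear_def)
  have pos: "0 < B u u" if "u \<noteq> 0" for u
  proof -
    have "\<tau> u \<noteq> 0" using coords_\<tau>[of u] that by auto
    then show ?thesis using tangent_norm_squared(2)[OF g x \<tau>_mem] by (simp add: B_def)
  qed
  define L where "L = (\<lambda>u. differential A F x (\<tau> u))"
  have L: "L (a *\<^sub>R u + b *\<^sub>R w) = a *\<^sub>R L u + b *\<^sub>R L w" for a b u w
    by (simp add: L_def \<tau>_lin differential_linear[OF F x])
  have "linear L"
    using L[of 1 _ 1] L[of _ _ 0 0] by (intro linearI) simp_all
  define h where "h = (\<lambda>u. support_fun C (L u))"
  have h: "convex_on UNIV h"
    by (rule convex_onI) (auto simp: h_def L intro!: support_fun_sublinear[OF C])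
  \<comment> \<open>Any fixed \<open>w\<close> in \<open>C\<close> bounds the supremum from below by
    a linear functional, hence by a multiple of the norm.\<close>
  obtain b where lower: "\<And>u. - b * norm u \<le> h u"
  proof -
    obtain w where w: "w \<in> C" using C(2) by blast
    obtain l where l: "\<And>u. norm (L u) \<le> norm u * l"
      using linear_conv_bounded_linear[of L] \<open>linear L\<close> bounded_linear.bounded by blast
    have "- (l * norm w) * norm u \<le> h u" for u
    proof -
      have "- (L u \<bullet> w) \<le> norm (L u) * norm w"
        using norm_cauchy_schwarz[of "- L u" w] by simp
      also have "\<dots> \<le> norm u * l * norm w" by (intro mult_right_mono l) simp
      finally show ?thesis
        using inner_le_support_fun[OF C(1) w, of "L u"] by (simp add: h_def mult_ac)
    qed
    then show ?thesis using that by blast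
  qed
  have zero: "h 0 \<le> 0"
    using L[of 0 0 0 0] C(2) by (simp add: h_def support_fun_zero)
  let ?P = "\<lambda>d. support_fun C (differential A F x d) + (tangent_norm g x d)\<^sup>2 / 2"
  have P: "?P (\<tau> u) = h u + B u u / 2" for u
    using tangent_norm_squared(1)[OF g x \<tau>_mem] by (simp add: h_def L_def B_def)
  have iff: "is_arg_min ?P (\<lambda>d. d \<in> ?T) (\<tau> u) \<longleftrightarrow> (\<forall>w. h u + B u u / 2 \<le> h w + B w w / 2)" for u
  proof -
    have "(\<forall>Y. Y \<in> ?T \<longrightarrow> ?P (\<tau> u) \<le> ?P Y) \<longleftrightarrow> (\<forall>w. ?P (\<tau> u) \<le> ?P (\<tau> w))"
      using \<tau>_mem \<tau>_coords by metis
    then show ?thesis by (auto simp: is_arg_min_linorder \<tau>_mem P)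
  qed
  obtain u where u: "\<And>w. h u + B u u / 2 \<le> h w + B w w / 2"
    using ex_arg_min_quadratic_regularisation[OF B pos h lower zero] by blast
  have "\<exists>!d. is_arg_min ?P (\<lambda>d. d \<in> ?T) d"
  proof (rule ex1I)
    show "is_arg_min ?P (\<lambda>d. d \<in> ?T) (\<tau> u)" using iff u by blast
    fix d assume d: "is_arg_min ?P (\<lambda>d. d \<in> ?T) d"
    then have "d = \<tau> (d c)" using \<tau>_coords by (auto simp: is_arg_min_def)
    moreover from this d have "d c = u"
      using arg_min_quadratic_regularisation_unique[OF B pos h, of "d c" u] iff[of "d c"] u by simp
    ultimately show "d = \<tau> u" by simp
  qed
  then show ?thesis
    unfolding steepest_descent_def by (rule theI')
qed

lemma steepest_descent_is_descent:
  fixes A :: "('a, 'e::euclidean_space) chart set" and C :: "'b::euclidean_space set"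
  assumes M: "riemannian_manifold M A g" and R: "retraction_on A R" and F: "C1_function A F"
    and C: "bounded C" "C \<noteq> {}" and x: "x \<in> atlas_carrier A"
    and v: "steepest_descent A g C F x \<noteq> 0"
  shows "support_fun C (differential A F x (steepest_descent A g C F x)) < 0"
proof -
  let ?v = "steepest_descent A g C F x"
  have M': "smooth_manifold M A" and g: "riemannian_metric A g"
    using M by (auto simp: riemannian_manifold_def)
  note min = steepest_descent_arg_min[OF M R F C x]
  have v_mem: "?v \<in> tangent_space A x" using min by (simp add: is_arg_min_def)
  have zero_mem: "0 \<in> tangent_space A x"
    by (rule subspace_0[OF subspace_tangent_space[OF M']])
  have "tangent_norm g x 0 = 0"
  proof -
    have "g x (0 *\<^sub>R 0) 0 = 0 * g x 0 0"
      using g x zero_mem unfolding riemannian_metric_def by blast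
    then show ?thesis by (simp add: tangent_norm_def)
  qed
  moreover have "differential A F x 0 = 0"
    using differential_linear[OF F x, of 0 0 0 0] by simp
  \<comment> \<open>Minimality is tested against the zero vector; the quadratic term is positive for
    a nonzero minimiser.\<close>
  ultimately have "support_fun C (differential A F x ?v) + g x ?v ?v / 2 \<le> 0"
    using min zero_mem tangent_norm_squared(1)[OF g x v_mem]
    by (auto simp: is_arg_min_linorder support_fun_zero[OF C(2)] dest!: spec[of _ 0])
  then show ?thesis using tangent_norm_squared(2)[OF g x v_mem v] by simp
qed

text \<open>Both retraction axioms enter: \<open>R x 0 = x\<close> fixes the base point, and the
  derivative at 0 is the identity.\<close>

lemma psi_zero:
  assumes "retraction_on A R" "x \<in> atlas_carrier A" "d \<in> tangent_space A x"
  shows "psi A C F R x d 0 = support_fun C (differential A F x d)"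
  using assms by (simp add: psi_def retraction_on_def)


section \<open>The descent estimate along the iterates\<close>

theorem proposition4p5:
  fixes K C :: "(real ^ 'm) set" and e :: "real ^ 'm" and c1 c2 :: real
    and M :: "'a topology" and A :: "('a, real ^ 'n) chart set"
    and g :: "'a \<Rightarrow> ('a, real ^ 'n) tangent_vector \<Rightarrow> ('a, real ^ 'n) tangent_vector \<Rightarrow> real"
    and F :: "'a \<Rightarrow> real ^ 'm"
    and R :: "'a \<Rightarrow> ('a, real ^ 'n) tangent_vector \<Rightarrow> 'a"
    and x :: "nat \<Rightarrow> 'a" and d :: "nat \<Rightarrow> ('a, real ^ 'n) tangent_vector"
    and t \<beta> :: "nat \<Rightarrow> real"
  defines "v \<equiv> steepest_descent A g C F"
    and "\<psi> \<equiv> psi A C F R"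
  assumes K: "closed K" "convex K" "cone K" "K \<inter> uminus ` K = {0}" "interior K \<noteq> {}"
    and C: "compact C" "C \<subseteq> dual_cone K - {0}" "dual_cone K = cone hull (convex hull C)"
    and e: "e \<in> K" "\<forall>\<omega>\<in>C. 0 < \<omega> \<bullet> e \<and> \<omega> \<bullet> e \<le> 1"
    and c12: "0 < c1" "c1 < c2" "c2 < 1"
    and M: "riemannian_manifold M A g"
    and F: "C1_function A F"
    and R: "retraction_on A R"
    and gen: "ncg_generated A g C F R x d t \<beta>"
    and beta: "\<forall>k\<ge>1. \<psi> (x k) (v (x k)) 0 / \<psi> (x (k - 1)) (d (k - 1)) 0 \<ge> \<beta> k \<and> \<beta> k > 0"
    and wolfe1: "\<forall>k. cone_le K (F (R (x k) (t k *\<^sub>R d k)))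
      (F (x k) + (c1 * t k * support_fun C (differential A F (x k) (d k))) *\<^sub>R e)"
    and wolfe2: "\<forall>k. \<bar>\<psi> (x k) (d k) (t k *\<^sub>R d k)\<bar> \<le> c2 * \<bar>\<psi> (x k) (d k) 0\<bar>"
    and nonstop: "\<forall>k. v (x k) \<noteq> 0"
  shows "\<forall>k. \<psi> (x k) (d k) 0 \<le> (1 - c2) * \<psi> (x k) (v (x k)) 0
           \<and> (1 - c2) * \<psi> (x k) (v (x k)) 0 < 0"
proof -
  have smooth: "smooth_manifold M A" using M by (simp add: riemannian_manifold_def)
  have C': "bounded C" "C \<noteq> {}"
  proof -
    show "bounded C" using C(1) by (rule compact_imp_bounded)
    \<comment> \<open>The cone generated by the empty set is empty, whereas the dual cone contains
      0.\<close>
    have "0 \<in> dual_cone K" by (simp add: dual_cone_def)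
    then show "C \<noteq> {}" using C(3) cone_hull_empty_iff[of C] by auto
  qed
  let ?T = "\<lambda>k. tangent_space A (x k)"
  let ?transport = "\<lambda>k. fibre_differential A (x k) (R (x k)) (t k *\<^sub>R d k) (d k)"
  have x0: "x 0 \<in> atlas_carrier A" using gen by (simp add: ncg_generated_def)
  \<comment> \<open>Since the method never stops, its guarded recursion holds at every
    index.\<close>
  have d0: "d 0 = v (x 0)"
    and dSuc: "d (Suc k) = v (x (Suc k)) + \<beta> (Suc k) *\<^sub>R ?transport k"
    and xSuc: "x (Suc k) = R (x k) (t k *\<^sub>R d k)" for k
    using gen nonstop unfolding ncg_generated_def v_def
    by (metis, metis diff_Suc_1 nat.distinct(1), metis)
  have v_mem: "v p \<in> tangent_space A p" if "p \<in> atlas_carrier A" for p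
    using steepest_descent_arg_min[OF M R F C' that] by (simp add: v_def is_arg_min_def)
  have scaled: "t k *\<^sub>R d k \<in> ?T k" if "d k \<in> ?T k" for k
    using subspace_scale[OF subspace_tangent_space[OF smooth] that] .
  have transport_mem: "?transport k \<in> ?T (Suc k)" if "x k \<in> atlas_carrier A" "d k \<in> ?T k" for k
    unfolding xSuc using fibre_differential_mem_tangent_space[OF smooth R that(1) scaled[OF that(2)]] .
  \<comment> \<open>Both claims are proved jointly: the next point needs a tangent direction, and
    the next direction is tangent at that next point.\<close>
  have inv: "x k \<in> atlas_carrier A \<and> d k \<in> ?T k" for k
  proof (induction k)
    case 0
    then show ?case using x0 v_mem d0 by simp
  next
    case (Suc k)
    then have "x (Suc k) \<in> atlas_carrier A"
      unfolding xSuc using retraction_mem_carrier[OF R _ scaled] by blast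
    moreover from this Suc have "d (Suc k) \<in> ?T (Suc k)"
      unfolding dSuc
      by (intro subspace_add[OF subspace_tangent_space[OF smooth]]
          subspace_scale[OF subspace_tangent_space[OF smooth]] v_mem transport_mem) auto
    ultimately show ?case by blast
  qed
  have \<psi>0: "\<psi> (x k) X 0 = support_fun C (differential A F (x k) X)" if "X \<in> ?T k" for k X
    unfolding \<psi>_def using psi_zero[OF R _ that] inv by blast
  have neg: "\<psi> (x k) (v (x k)) 0 < 0" for k
    using steepest_descent_is_descent[OF M R F C', of "x k"] inv[of k] nonstop \<psi>0[OF v_mem]
    by (simp add: v_def)
  have bound: "\<psi> (x k) (d k) 0 \<le> (1 - c2) * \<psi> (x k) (v (x k)) 0" for k
  proof (induction k)
    case 0
    have "c2 * \<psi> (x 0) (v (x 0)) 0 \<le> 0"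
      using neg[of 0] c12 by (intro mult_nonneg_nonpos) auto
    then have "\<psi> (x 0) (v (x 0)) 0 \<le> (1 - c2) * \<psi> (x 0) (v (x 0)) 0"
      unfolding left_diff_distrib by linarith
    then show ?case unfolding d0 .
  next
    case (Suc k)
    let ?b = "\<beta> (Suc k)" and ?p = "\<psi> (x k) (d k) 0" and ?q = "\<psi> (x (Suc k)) (v (x (Suc k))) 0"
    \<comment> \<open>The induction hypothesis is used only for the sign of \<open>?p\<close>, the
      denominator of the bound on \<open>?b\<close>.\<close>
    have "(1 - c2) * \<psi> (x k) (v (x k)) 0 < 0" using neg c12 by (intro mult_pos_neg) auto
    with Suc have p: "?p < 0" by linarith
    have b: "?b \<le> ?q / ?p" "0 < ?b" using beta by auto
    have "\<psi> (x (Suc k)) (d (Suc k)) 0 =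
        support_fun C (differential A F (x (Suc k)) (1 *\<^sub>R v (x (Suc k)) + ?b *\<^sub>R ?transport k))"
      using \<psi>0[of "d (Suc k)" "Suc k"] inv[of "Suc k"] dSuc[of k] by simp
    also have "\<dots> \<le> 1 * support_fun C (differential A F (x (Suc k)) (v (x (Suc k)))) +
        ?b * support_fun C (differential A F (x (Suc k)) (?transport k))"
      unfolding differential_linear[OF F conjunct1[OF inv]]
      using b(2) by (intro support_fun_sublinear[OF C']) auto
    also have "\<dots> = ?q + ?b * \<psi> (x k) (d k) (t k *\<^sub>R d k)"
    proof -
      \<comment> \<open>The value of \<psi> at the end of step \<open>k\<close> is already a
        derivative at \<open>x (Suc k)\<close> along the transported direction.\<close>
      have "\<psi> (x k) (d k) (t k *\<^sub>R d k) =
          support_fun C (differential A F (x (Suc k)) (?transport k))"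
        by (simp add: \<psi>_def psi_def xSuc)
      then show ?thesis
        using \<psi>0[OF v_mem[OF conjunct1[OF inv]], of "Suc k"] by simp
    qed
    also have "\<dots> \<le> ?q + ?b * (c2 * - ?p)"
      using wolfe2[rule_format, of k] p b(2) by (intro add_left_mono mult_left_mono) auto
    also have "\<dots> = ?q - c2 * (?b * ?p)" by simp
    \<comment> \<open>Multiplying \<open>?b \<le> ?q / ?p\<close> by the negative \<open>?p\<close>
      reverses it to \<open>?q \<le> ?b * ?p\<close>.\<close>
    also have "\<dots> \<le> ?q - c2 * ?q"
      using b(1) p c12 by (intro diff_left_mono mult_left_mono) (auto simp: neg_le_divide_eq)
    finally show ?case unfolding left_diff_distrib by linarith
  qed
  show ?thesis
    using bound neg c12 by (auto intro!: mult_pos_neg)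
qed

end
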